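(* Let $\mathcal P$ be the generic countable homogeneous partial order. The isomorphism relation on the class of countable partial orders is Borel reducible to the conjugacy relation on $\mathrm{Aut}(\mathcal P)$. Hence the conjugacy relation on $\mathrm{Aut}(\mathcal P)$ is Borel complete.
   Context: $\mathcal P$ is the Fraïssé limit of the class of finite partial orders: the unique (up to isomorphism) countable partial order that is homogeneous (every isomorphism between finite suborders extends to an automorphism) and contains a copy of every finite partial order. Countable partial orders are coded as binary relations on $\mathbb N$, forming a standard Borel space. $\mathrm{Aut}(\mathcal P)$ is a Polish group, and its conjugacy relation is $\phi\sim\psi$ iff $\alpha\phi\alpha^{-1}=\psi$ for some $\alpha\in\mathrm{Aut}(\mathcal P)$. For equivalence relations $E,F$ on standard Borel spaces $X,Y$, $E$ is Borel reducible to $F$ if there is a Borel $f\colon X\to Y$ with $x\mathrel{E}x'\iff f(x)\mathrel{F}f(x')$. $E$ is Borel complete if it is Borel reducible to the isomorphism relation on some class of countable structures and the isomorphism relation on every class of countable structures is Borel reducible to $E$. *)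

theory Defs
  imports "HOL-Analysis.Analysis"
begin

definition borel_reducible ::
  "'a measure \<Rightarrow> ('a \<Rightarrow> 'a \<Rightarrow> bool) \<Rightarrow> 'b measure \<Rightarrow> ('b \<Rightarrow> 'b \<Rightarrow> bool) \<Rightarrow> bool" where
  "borel_reducible X E Y F \<longleftrightarrow>
     (\<exists>f \<in> measurable X Y. \<forall>x\<in>space X. \<forall>x'\<in>space X. E x x' \<longleftrightarrow> F (f x) (f x'))"

definition is_po :: "(nat \<Rightarrow> nat \<Rightarrow> bool) \<Rightarrow> bool" where
  "is_po R \<longleftrightarrow> (\<forall>x. R x x) \<and> (\<forall>x y. R x y \<and> R y x \<longrightarrow> x = y)
      \<and> (\<forall>x y z. R x y \<and> R y z \<longrightarrow> R x z)"

text \<open>Space of binary relations on nat: Cantor space 2^(nat x nat) with the product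
  (= Borel) sigma algebra.\<close>
definition rel_space :: "(nat \<Rightarrow> nat \<Rightarrow> bool) measure" where
  "rel_space = PiM UNIV (\<lambda>_. PiM UNIV (\<lambda>_. count_space UNIV))"

definition PO_space :: "(nat \<Rightarrow> nat \<Rightarrow> bool) measure" where
  "PO_space = restrict_space rel_space {R. is_po R}"

definition po_iso :: "(nat \<Rightarrow> nat \<Rightarrow> bool) \<Rightarrow> (nat \<Rightarrow> nat \<Rightarrow> bool) \<Rightarrow> bool" where
  "po_iso R S \<longleftrightarrow> (\<exists>h. bij h \<and> (\<forall>x y. R x y \<longleftrightarrow> S (h x) (h y)))"

definition Aut :: "(nat \<Rightarrow> nat \<Rightarrow> bool) \<Rightarrow> (nat \<Rightarrow> nat) set" where
  "Aut R = {\<sigma>. bij \<sigma> \<and> (\<forall>x y. R x y \<longleftrightarrow> R (\<sigma> x) (\<sigma> y))}"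

definition homogeneous_po :: "(nat \<Rightarrow> nat \<Rightarrow> bool) \<Rightarrow> bool" where
  "homogeneous_po R \<longleftrightarrow>
     (\<forall>A B p. finite A \<and> bij_betw p A B \<and> (\<forall>x\<in>A. \<forall>y\<in>A. R x y \<longleftrightarrow> R (p x) (p y))
        \<longrightarrow> (\<exists>\<sigma>\<in>Aut R. \<forall>x\<in>A. \<sigma> x = p x))"

text \<open>Contains a copy of every finite partial order (finite partial orders are, up to
  isomorphism, partial orders on some initial segment of nat).\<close>
definition universal_po :: "(nat \<Rightarrow> nat \<Rightarrow> bool) \<Rightarrow> bool" where
  "universal_po R \<longleftrightarrow>
     (\<forall>(n::nat) (Q :: nat \<Rightarrow> nat \<Rightarrow> bool).
        ((\<forall>x<n. Q x x) \<and> (\<forall>x<n. \<forall>y<n. Q x y \<and> Q y x \<longrightarrow> x = y)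
         \<and> (\<forall>x<n. \<forall>y<n. \<forall>z<n. Q x y \<and> Q y z \<longrightarrow> Q x z))
        \<longrightarrow> (\<exists>e. inj_on e {..<n} \<and> (\<forall>x<n. \<forall>y<n. Q x y \<longleftrightarrow> R (e x) (e y))))"

definition generic_po :: "(nat \<Rightarrow> nat \<Rightarrow> bool) \<Rightarrow> bool" where
  "generic_po R \<longleftrightarrow> is_po R \<and> homogeneous_po R \<and> universal_po R"

text \<open>Aut(R) as a subspace of Baire space nat^nat (product = Borel sigma algebra).\<close>
definition baire_space :: "(nat \<Rightarrow> nat) measure" where
  "baire_space = PiM UNIV (\<lambda>_. count_space UNIV)"

definition Aut_space :: "(nat \<Rightarrow> nat \<Rightarrow> bool) \<Rightarrow> (nat \<Rightarrow> nat) measure" where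
  "Aut_space R = restrict_space baire_space (Aut R)"

definition conj_rel :: "(nat \<Rightarrow> nat \<Rightarrow> bool) \<Rightarrow> (nat \<Rightarrow> nat) \<Rightarrow> (nat \<Rightarrow> nat) \<Rightarrow> bool" where
  "conj_rel R \<phi> \<psi> \<longleftrightarrow> (\<exists>\<alpha>\<in>Aut R. \<alpha> \<circ> \<phi> \<circ> inv \<alpha> = \<psi>)"

text \<open>A countable relational language is given by a set I of relation-symbol indices
  (I a subset of nat) and arities ar. An L-structure with universe nat is coded as
  S :: nat \<Rightarrow> nat list \<Rightarrow> bool, where S i xs says that the tuple xs lies in relation i;
  S is required to vanish outside the symbols/arity.\<close>
definition Mod :: "nat set \<Rightarrow> (nat \<Rightarrow> nat) \<Rightarrow> (nat \<Rightarrow> nat list \<Rightarrow> bool) set" where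
  "Mod I ar = {S. \<forall>i xs. S i xs \<longrightarrow> i \<in> I \<and> length xs = ar i}"

definition struct_space :: "nat set \<Rightarrow> (nat \<Rightarrow> nat) \<Rightarrow> (nat \<Rightarrow> nat list \<Rightarrow> bool) measure" where
  "struct_space I ar = restrict_space (PiM UNIV (\<lambda>_. PiM UNIV (\<lambda>_. count_space UNIV))) (Mod I ar)"

definition struct_iso :: "(nat \<Rightarrow> nat list \<Rightarrow> bool) \<Rightarrow> (nat \<Rightarrow> nat list \<Rightarrow> bool) \<Rightarrow> bool" where
  "struct_iso S T \<longleftrightarrow> (\<exists>h. bij h \<and> (\<forall>i xs. S i xs \<longleftrightarrow> T i (map h xs)))"

definition struct_class :: "nat set \<Rightarrow> (nat \<Rightarrow> nat) \<Rightarrow> (nat \<Rightarrow> nat list \<Rightarrow> bool) set \<Rightarrow> bool" where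
  "struct_class I ar C \<longleftrightarrow> C \<in> sets (struct_space I ar)
     \<and> (\<forall>S\<in>C. \<forall>T\<in>Mod I ar. struct_iso S T \<longrightarrow> T \<in> C)"

definition class_space ::
  "nat set \<Rightarrow> (nat \<Rightarrow> nat) \<Rightarrow> (nat \<Rightarrow> nat list \<Rightarrow> bool) set \<Rightarrow> (nat \<Rightarrow> nat list \<Rightarrow> bool) measure" where
  "class_space I ar C = restrict_space (struct_space I ar) C"

definition borel_complete :: "'a measure \<Rightarrow> ('a \<Rightarrow> 'a \<Rightarrow> bool) \<Rightarrow> bool" where
  "borel_complete X E \<longleftrightarrow>
     (\<exists>I ar C. struct_class I ar C \<and> borel_reducible X E (class_space I ar C) struct_iso)
   \<and> (\<forall>I ar C. struct_class I ar C \<longrightarrow> borel_reducible (class_space I ar C) struct_iso X E)"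

end

theory Submission
  imports Defs
begin

text \<open>
  A partial order \<open>Q\<close> is embedded in a copy of the generic order as the set of fixed points of an
  automorphism. Iterating the free adjunction of points with prescribed finite sets of lower and
  upper bounds, and adjoining each such point in copies indexed by the integers, gives an order
  with the extension property; the shift of the indices is an automorphism whose fixed points are
  exactly the elements of \<open>Q\<close>. The construction is functorial in \<open>Q\<close>, and a back-and-forth
  argument that always takes least witnesses carries it to \<open>P\<close> in a Borel way.

  An arbitrary countable structure is coded by a partial order whose elements carry numerical
  labels, where the label of a node is read off from its position over a definable chain of
  type omega. In the other direction an automorphism \<open>\<phi>\<close> is sent to the structure consisting
  of \<open>P\<close> and the graph of \<open>\<phi>\<close>.
\<close>

section \<open>Free extensions of a partial order\<close>

text \<open>
  \<open>Ext L U k\<close> is the \<open>k\<close>-th copy of a point above \<open>L\<close> and below \<open>U\<close>. To make every term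
  meaningful for every \<open>Q\<close>, only those elements of \<open>U\<close> count that lie strictly above all of \<open>L\<close>.
  Hence neither the set of terms nor the shift depends on \<open>Q\<close>.
\<close>

datatype ('a, 'k) ext = Base 'a | Ext "('a, 'k) ext list" "('a, 'k) ext list" 'k

instance ext :: (countable, countable) countable
  by countable_datatype

text \<open>Transitivity is deliberately not a rule: each recursive premise compares a pair of
  smaller total size, so the relation between two given terms can be computed by recursion.\<close>

inductive ext_le :: "('a \<Rightarrow> 'a \<Rightarrow> bool) \<Rightarrow> ('a, 'k) ext \<Rightarrow> ('a, 'k) ext \<Rightarrow> bool"
  for Q where
  base: "Q a b \<Longrightarrow> ext_le Q (Base a) (Base b)"
| refl: "ext_le Q x x"
| lower: "l \<in> set L \<Longrightarrow> ext_le Q x l \<Longrightarrow> ext_le Q x (Ext L U k)"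
| upper: "u \<in> set U \<Longrightarrow> \<forall>l\<in>set L. ext_le Q l u \<and> l \<noteq> u \<Longrightarrow> ext_le Q u y \<Longrightarrow> ext_le Q (Ext L U k) y"

section \<open>Order axioms for the generated relation\<close>

lemma size_ext_lower: "l \<in> set L \<Longrightarrow> size l < size (Ext L U k)"
  and size_ext_upper: "u \<in> set U \<Longrightarrow> size u < size (Ext L U k)"
  using size_list_estimation'[of l L "size l" size] size_list_estimation'[of u U "size u" size]
  by auto

text \<open>Cut elimination by induction on total size. In the critical case \<open>y\<close> is an
  \<open>Ext\<close> term entered by \<open>lower\<close> through \<open>l\<close> and left by
  \<open>upper\<close> through \<open>u\<close>; the side condition gives \<open>l\<close> \<le>
  \<open>u\<close>, and the cut at \<open>y\<close> is replaced by cuts at \<open>l\<close> and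
  \<open>u\<close>.\<close>

lemma ext_le_trans:
  assumes Q: "transp Q" and "ext_le Q x y" "ext_le Q y z"
  shows "ext_le Q x z"
  using assms(2,3)
proof (induction "size x + size y + size z" arbitrary: x y z rule: less_induct)
  case less
  note IH = less.hyps and xy = less.prems(1) and yz = less.prems(2)
  from xy show ?case
  proof cases
    case refl
    with yz show ?thesis by simp
  next
    case (upper u U L k)
    have "ext_le Q u z"
      using IH[of u y z] size_ext_upper[OF upper(2), of L k] upper(1,4) yz by simp
    then show ?thesis using upper ext_le.upper by metis
  next
    case xy': (base a b)
    from yz show ?thesis
    proof cases
      case (base a' b')
      then show ?thesis using xy' Q by (auto intro: ext_le.base dest: transpD)
    next
      case (lower l L U k)
      have "ext_le Q x l"
        using IH[of x y l] size_ext_lower[OF lower(2), of U k] lower(1,3) xy by simp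
      then show ?thesis using lower ext_le.lower by metis
    qed (use xy xy' in auto)
  next
    case xy': (lower l L U k)
    from yz show ?thesis
    proof cases
      case (lower l' L' U' k')
      have "ext_le Q x l'"
        using IH[of x y l'] size_ext_lower[OF lower(2), of U' k'] lower(1,3) xy by simp
      then show ?thesis using lower ext_le.lower by metis
    next
      case (upper u U' L' k')
      have eq: "U' = U" "L' = L" using upper(1) xy'(1) by auto
      have s: "size l < size y" "size u < size y" "size l + size u < size y"
        using xy' upper size_ext_lower[of l L U k] size_ext_upper[of u U L k]
          size_list_estimation'[of l L "size l" size] size_list_estimation'[of u U "size u" size] eq
        by auto
      have "ext_le Q l u" using upper(3) xy'(2) eq by auto
      then have "ext_le Q x u" using IH[of x l u] s xy'(3) by simp
      then show ?thesis using IH[of x u z] s upper(4) by simp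
    qed (use xy xy' in auto)
  qed
qed

text \<open>Induction on total size, with the smaller term called \<open>x\<close>. If
  \<open>y\<close> is entered by \<open>lower\<close> and left by \<open>upper\<close>, both bounds
  equal \<open>x\<close>, against the condition \<open>l \<noteq> u\<close>. The cases
  \<open>low\<close> and \<open>up\<close> would make \<open>x\<close> equal to a proper
  subterm.\<close>

lemma ext_le_antisym:
  fixes x y :: "('a, 'k) ext"
  assumes Q: "transp Q" "antisymp Q" and "ext_le Q x y" "ext_le Q y x"
  shows "x = y"
proof -
  have *: "x = y" if "size x \<le> size y" "ext_le Q x y" "ext_le Q y x" for x y :: "('a, 'k) ext"
    using that
  proof (induction "size x + size y" arbitrary: x y rule: less_induct)
    case less
    have IH: "u = v" if "size u + size v < size x + size y" "ext_le Q u v" "ext_le Q v u"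
      for u v :: "('a, 'k) ext"
      using less.hyps[of u v] less.hyps[of v u] that by fastforce
    note tr = ext_le_trans[OF Q(1)] and xy = less.prems(2) and yx = less.prems(3)
    have low: False if "x = Ext L U k" "l \<in> set L" "ext_le Q y l" for L U k l
      using IH[of l x] size_ext_lower[of l L U k] that less.prems tr[OF xy that(3)]
        ext_le.lower[OF that(2) ext_le.refl, of Q U k] by auto
    have up: False if "x = Ext L U k" "u \<in> set U" "\<forall>l\<in>set L. ext_le Q l u \<and> l \<noteq> u"
        "ext_le Q u y" for L U k u
      using IH[of u x] size_ext_upper[of u U L k] that less.prems tr[OF that(4) yx]
        ext_le.upper[OF that(2,3) ext_le.refl, of k] by auto
    from xy show ?case
    proof cases
      case xy': (base a b)
      from yx show ?thesis by cases (use xy' Q in \<open>auto dest: antisympD\<close>)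
    next
      case xy': (lower l L U k)
      have "ext_le Q l y" using xy' ext_le.lower ext_le.refl by metis
      then have xl: "x = l"
        using IH[of x l] size_ext_lower[of l L U k] xy' tr[OF _ yx] by simp
      from yx show ?thesis
      proof cases
        case (upper u U' L' k')
        have eq: "U' = U" "L' = L" using upper(1) xy'(1) by auto
        have "ext_le Q y u" using upper ext_le.upper ext_le.refl by metis
        then have "x = u"
          using IH[of x u] size_ext_upper[of u U L k] xy'(1) upper(2,4) eq tr[OF xy] by simp
        then show ?thesis using xl upper(3) xy'(2) eq by auto
      qed (use xy' low in auto)
    qed (use up in auto)
  qed
  show ?thesis using *[of x y] *[of y x] assms(3,4) by fastforce
qed

lemma ext_le_Base_iff: "reflp Q \<Longrightarrow> ext_le Q (Base a) (Base b) \<longleftrightarrow> Q a b"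
  by (subst ext_le.simps) (auto dest: reflpD)

section \<open>Fresh copies and the extension property\<close>

lemma finite_set2_ext: "finite (set2_ext x)"
  by (induction x) auto

text \<open>\<open>set2_ext y\<close> is the set of copy indices in \<open>y\<close>. With
  \<open>k\<close> fresh, \<open>refl\<close> cannot apply, and \<open>lower\<close> only leads to
  subterms of \<open>y\<close>, where \<open>k\<close> is again fresh; so \<open>Ext L U k\<close>
  has to be left through \<open>upper\<close>.\<close>

lemma Ext_le_fresh_iff:
  assumes "k \<notin> set2_ext y"
  shows "ext_le Q (Ext L U k) y \<longleftrightarrow>
    (\<exists>u\<in>set U. (\<forall>l\<in>set L. ext_le Q l u \<and> l \<noteq> u) \<and> ext_le Q u y)"
  using assms
proof (induction y)
  case (Base b)
  show ?case by (subst ext_le.simps) auto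
next
  case (Ext L' U' k')
  have IH: "ext_le Q (Ext L U k) l \<Longrightarrow>
      \<exists>u\<in>set U. (\<forall>l\<in>set L. ext_le Q l u \<and> l \<noteq> u) \<and> ext_le Q u (Ext L' U' k')"
    if "l \<in> set L'" for l
    using Ext.IH(1)[OF that] Ext.prems that by (auto intro: ext_le.lower)
  show ?case (is "?l \<longleftrightarrow> ?r")
  proof
    assume ?l
    then show ?r by cases (use Ext.prems IH in auto)
  qed (auto intro: ext_le.upper)
qed

lemma le_Ext_fresh_iff:
  assumes "k \<notin> set2_ext y"
  shows "ext_le Q y (Ext L U k) \<longleftrightarrow> (\<exists>l\<in>set L. ext_le Q y l)"
  using assms
proof (induction y)
  case (Base b)
  show ?case by (subst ext_le.simps) auto
next
  case (Ext L' U' k')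
  show ?case (is "?l \<longleftrightarrow> ?r")
  proof
    assume ?l
    then show ?r
    proof cases
      case (upper u)
      then show ?thesis using Ext.IH(2)[of u] Ext.prems by (auto intro: ext_le.upper)
    qed (use Ext.prems in auto)
  qed (auto intro: ext_le.lower)
qed

text \<open>One-point extensions: \<open>x\<close> realises over \<open>F\<close> the cut generated
  by \<open>L\<close> and \<open>U\<close>. In a partial order such an \<open>x\<close> lies outside
  \<open>F\<close>, since otherwise some \<open>u\<close> \<le> \<open>x\<close> \<le>
  \<open>l\<close>.\<close>

definition extension_property :: "('a \<Rightarrow> 'a \<Rightarrow> bool) \<Rightarrow> bool" where
  "extension_property R \<longleftrightarrow>
    (\<forall>F L U. finite F \<and> finite L \<and> finite U \<and> (\<forall>l\<in>L. \<forall>u\<in>U. R l u \<and> l \<noteq> u) \<longrightarrow>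
      (\<exists>x. \<forall>y\<in>F. (R y x \<longleftrightarrow> (\<exists>l\<in>L. R y l)) \<and> (R x y \<longleftrightarrow> (\<exists>u\<in>U. R u y))))"

lemma extension_property_ext_le:
  assumes "infinite (UNIV :: 'k set)"
  shows "extension_property (ext_le Q :: ('a, 'k) ext \<Rightarrow> _)"
  unfolding extension_property_def
proof (intro allI impI, elim conjE)
  fix F L U :: "('a, 'k) ext set"
  assume fin: "finite F" "finite L" "finite U" and LU: "\<forall>l\<in>L. \<forall>u\<in>U. ext_le Q l u \<and> l \<noteq> u"
  obtain Ls Us where Ls: "set Ls = L" "set Us = U" using fin finite_list by metis
  have "finite (\<Union>y\<in>F. set2_ext y)" using fin finite_set2_ext by blast
  then obtain k where k: "k \<notin> (\<Union>y\<in>F. set2_ext y)"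
    using assms ex_new_if_finite by blast
  then show "\<exists>x. \<forall>y\<in>F. (ext_le Q y x \<longleftrightarrow> (\<exists>l\<in>L. ext_le Q y l)) \<and>
      (ext_le Q x y \<longleftrightarrow> (\<exists>u\<in>U. ext_le Q u y))"
    using Ls LU
    by (intro exI[of _ "Ext Ls Us k"]) (auto simp: Ext_le_fresh_iff le_Ext_fresh_iff)
qed

section \<open>Functoriality and measurability of the free extension\<close>

lemma ext_le_map:
  assumes "ext_le Q x y" "\<And>a b. Q a b \<Longrightarrow> Q' (g a) (g b)" "inj g" "inj s"
  shows "ext_le Q' (map_ext g s x) (map_ext g s y)"
  using assms(1)
proof (induction rule: ext_le.induct)
  \<comment> \<open>Injectivity of the map on terms preserves the side condition
    \<open>l \<noteq> u\<close>.\<close>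
  case (upper u U L y k)
  then show ?case
    using ext.inj_map[OF assms(3,4)] by (fastforce intro!: ext_le.upper simp: inj_eq)
next
  case (lower l L x U k)
  then show ?case by (auto intro!: ext_le.lower)
qed (auto intro: ext_le.intros assms(2))

lemma map_ext_inv:
  assumes "bij g" "bij s"
  shows "map_ext (inv g) (inv s) (map_ext g s x) = x" "map_ext g s (map_ext (inv g) (inv s) y) = y"
  using assms by (simp_all add: ext.map_comp inv_o_cancel surj_iff[THEN iffD1]
      bij_is_inj bij_is_surj ext.map_id)

lemma bij_map_ext: "bij g \<Longrightarrow> bij s \<Longrightarrow> bij (map_ext g s)"
  by (rule bij_betw_byWitness[where f' = "map_ext (inv g) (inv s)"]) (auto simp: map_ext_inv)

lemma ext_le_map_iff:
  assumes "\<And>a b. Q a b \<longleftrightarrow> Q' (g a) (g b)" "bij g" "bij s"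
  shows "ext_le Q' (map_ext g s x) (map_ext g s y) \<longleftrightarrow> ext_le Q x y"
proof
  assume "ext_le Q' (map_ext g s x) (map_ext g s y)"
  then have "ext_le Q (map_ext (inv g) (inv s) (map_ext g s x)) (map_ext (inv g) (inv s) (map_ext g s y))"
    by (rule ext_le_map)
      (use assms in \<open>auto simp: bij_is_surj surj_f_inv_f bij_imp_bij_inv bij_is_inj\<close>)
  then show "ext_le Q x y" by (simp add: map_ext_inv assms)
qed (use assms in \<open>auto intro!: ext_le_map dest: bij_is_inj\<close>)

text \<open>Recursion on total size presents the comparison of two fixed terms as a finite Boolean
  combination of values \<open>Q x a b\<close>.\<close>

lemma pred_ext_le:
  fixes Q :: "'x \<Rightarrow> 'a \<Rightarrow> 'a \<Rightarrow> bool"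
  assumes Q: "\<And>a b. Measurable.pred M (\<lambda>x. Q x a b)"
  shows "Measurable.pred M (\<lambda>x. ext_le (Q x) s t)"
proof (induction "size s + size t" arbitrary: s t rule: less_induct)
  case less
  have low: "Measurable.pred M (\<lambda>x. ext_le (Q x) s l)" if "t = Ext L U k" "l \<in> set L" for L U k l
    using less[of s l] that size_ext_lower by fastforce
  have up: "Measurable.pred M (\<lambda>x. ext_le (Q x) u t)" if "s = Ext L U k" "u \<in> set U" for L U k u
    using less[of u t] that size_ext_upper by fastforce
  have lu: "Measurable.pred M (\<lambda>x. ext_le (Q x) l u)"
    if "s = Ext L U k" "u \<in> set U" "l \<in> set L" for L U k u l
    using less[of l u] that
      size_list_estimation'[of l L "size l" size] size_list_estimation'[of u U "size u" size]
    by fastforce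
  have eq: "ext_le (Q x) s t \<longleftrightarrow> (case s of Base a \<Rightarrow> (case t of Base b \<Rightarrow> Q x a b | _ \<Rightarrow> False) | _ \<Rightarrow> False)
    \<or> s = t \<or> (case t of Ext L U k \<Rightarrow> \<exists>l\<in>set L. ext_le (Q x) s l | _ \<Rightarrow> False)
    \<or> (case s of Ext L U k \<Rightarrow> \<exists>u\<in>set U. (\<forall>l\<in>set L. ext_le (Q x) l u \<and> l \<noteq> u) \<and> ext_le (Q x) u t
         | _ \<Rightarrow> False)" for x
    by (subst ext_le.simps) (auto split: ext.splits)
  have "Measurable.pred M (\<lambda>x. case s of Base a \<Rightarrow> (case t of Base b \<Rightarrow> Q x a b | _ \<Rightarrow> False) | _ \<Rightarrow> False)"
    by (cases s; cases t) (auto intro: Q)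
  moreover have "Measurable.pred M (\<lambda>x. case t of Ext L U k \<Rightarrow> \<exists>l\<in>set L. ext_le (Q x) s l | _ \<Rightarrow> False)"
  proof (cases t)
    case (Ext L U k)
    show ?thesis
      unfolding Ext ext.case
      by (intro pred_intros_finite low[OF Ext]) auto
  qed simp
  moreover have "Measurable.pred M (\<lambda>x. case s of Ext L U k \<Rightarrow>
      \<exists>u\<in>set U. (\<forall>l\<in>set L. ext_le (Q x) l u \<and> l \<noteq> u) \<and> ext_le (Q x) u t | _ \<Rightarrow> False)"
  proof (cases s)
    case (Ext L U k)
    show ?thesis
      unfolding Ext ext.case
      by (intro pred_intros_finite pred_intros_logic
          up[OF Ext] lu[OF Ext]) auto
  qed simp
  ultimately show ?case
    unfolding eq by measurable
qed

section \<open>The generic order and back-and-forth\<close>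

lemma is_poD:
  assumes "is_po R"
  shows "R x x" "R x y \<Longrightarrow> R y x \<Longrightarrow> x = y" "R x y \<Longrightarrow> R y z \<Longrightarrow> R x z"
  using assms unfolding is_po_def by blast+

text \<open>Universality supplies a copy of \<open>F0\<close> together with the desired new point;
  homogeneity moves the copy of \<open>F0\<close> onto \<open>F0\<close> and takes the new point
  along.\<close>

lemma extension_property_generic_po:
  assumes "generic_po P"
  shows "extension_property P"
  unfolding extension_property_def
proof (intro allI impI, elim conjE)
  fix F0 L U :: "nat set"
  assume fin: "finite F0" "finite L" "finite U" and LU: "\<forall>l\<in>L. \<forall>u\<in>U. P l u \<and> l \<noteq> u"
  have po: "is_po P" and hom: "homogeneous_po P" and univ: "universal_po P"
    using assms by (auto simp: generic_po_def)
  note refl = is_poD(1)[OF po] and anti = is_poD(2)[OF po] and trans = is_poD(3)[OF po]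
  define n where "n = card F0"
  obtain c where c: "bij_betw c {..<n} F0"
    using ex_bij_betw_nat_finite[OF fin(1)] by (auto simp: n_def lessThan_atLeast0)
  \<comment> \<open>The indices below \<open>n\<close> stand for the elements of \<open>F0\<close>,
    and \<open>n\<close> for the new point, placed by \<open>L\<close> and \<open>U\<close>.\<close>
  define Q where "Q i j = (if i < n then if j < n then P (c i) (c j) else \<exists>l\<in>L. P (c i) l
      else if j < n then \<exists>u\<in>U. P u (c j) else True)" for i j
  have cross: False if "P y l" "l \<in> L" "P u y" "u \<in> U" for y l u
    using LU that trans anti by blast
  have "Q x y \<and> Q y x \<longrightarrow> x = y" if "x < Suc n" "y < Suc n" for x y
    using that anti c cross unfolding Q_def
    by (auto split: if_splits simp: bij_betw_def inj_on_def)
  moreover have "Q x y \<and> Q y z \<longrightarrow> Q x z" if "x < Suc n" "y < Suc n" "z < Suc n" for x y z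
    using that by (cases "x < n"; cases "y < n"; cases "z < n") (simp_all add: Q_def, (meson trans LU)+)
  moreover have "Q x x" for x by (simp add: Q_def refl)
  ultimately have "(\<forall>x<Suc n. Q x x) \<and> (\<forall>x<Suc n. \<forall>y<Suc n. Q x y \<and> Q y x \<longrightarrow> x = y) \<and>
      (\<forall>x<Suc n. \<forall>y<Suc n. \<forall>z<Suc n. Q x y \<and> Q y z \<longrightarrow> Q x z)"
    by meson
  from univ[unfolded universal_po_def, THEN spec, THEN spec, THEN mp, OF this]
  obtain e where e: "inj_on e {..<Suc n}"
    "\<And>x y. x < Suc n \<Longrightarrow> y < Suc n \<Longrightarrow> Q x y \<longleftrightarrow> P (e x) (e y)"
    by blast
  define p where "p = c \<circ> the_inv_into {..<n} e"
  have inj: "inj_on e {..<n}" using e(1) by (rule inj_on_subset) auto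
  have pe: "p (e i) = c i" if "i < n" for i
    using the_inv_into_f_f[OF inj, of i] that by (simp add: p_def)
  have "bij_betw p (e ` {..<n}) F0"
    unfolding p_def by (rule bij_betw_trans[OF _ c]) (simp add: inj inj_on_imp_bij_betw bij_betw_the_inv_into)
  moreover have "\<forall>x\<in>e ` {..<n}. \<forall>y\<in>e ` {..<n}. P x y \<longleftrightarrow> P (p x) (p y)"
    by (auto simp: pe Q_def simp flip: e(2))
  ultimately obtain \<sigma> where \<sigma>: "\<sigma> \<in> Aut P" "\<forall>x\<in>e ` {..<n}. \<sigma> x = p x"
    using hom unfolding homogeneous_po_def by (metis finite_imageI finite_lessThan)
  have \<sigma>_iff: "P (\<sigma> x) (\<sigma> y) \<longleftrightarrow> P x y" for x y using \<sigma>(1) by (auto simp: Aut_def)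
  show "\<exists>x. \<forall>y\<in>F0. (P y x \<longleftrightarrow> (\<exists>l\<in>L. P y l)) \<and> (P x y \<longleftrightarrow> (\<exists>u\<in>U. P u y))"
  proof (intro exI[of _ "\<sigma> (e n)"] ballI)
    fix y assume "y \<in> F0"
    then obtain i where i: "i < n" "y = \<sigma> (e i)"
      using c \<sigma>(2) pe by (auto simp: bij_betw_def)
    then have "y = c i" using \<sigma>(2) pe by auto
    then show "(P y (\<sigma> (e n)) \<longleftrightarrow> (\<exists>l\<in>L. P y l)) \<and> (P (\<sigma> (e n)) y \<longleftrightarrow> (\<exists>u\<in>U. P u y))"
      using e(2)[of i n] e(2)[of n i] i(1) unfolding i(2) \<sigma>_iff by (auto simp: Q_def)
  qed
qed

text \<open>A relation instead of a function makes back and forth symmetric. Between partial orders,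
  reflexivity and antisymmetry force \<open>G\<close> to be single-valued and injective.\<close>

definition partial_iso :: "('a \<Rightarrow> 'a \<Rightarrow> bool) \<Rightarrow> ('b \<Rightarrow> 'b \<Rightarrow> bool) \<Rightarrow> ('a \<times> 'b) set \<Rightarrow> bool" where
  "partial_iso R S G \<longleftrightarrow> (\<forall>(a, b)\<in>G. \<forall>(a', b')\<in>G. R a a' \<longleftrightarrow> S b b')"

lemma partial_iso_converse: "partial_iso S R (G\<inverse>) \<longleftrightarrow> partial_iso R S G"
  unfolding partial_iso_def by fast

text \<open>The images of the points below \<open>a\<close> lie strictly under those of the points
  above \<open>a\<close>, since a common image would put \<open>a\<close> into the domain. The
  extension property then realises the corresponding cut.\<close>

lemma partial_iso_extend:
  assumes R: "is_po R" and S: "is_po S" "extension_property S"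
    and G: "finite G" "partial_iso R S G"
  shows "\<exists>b. partial_iso R S (insert (a, b) G)"
proof (cases "a \<in> Domain G")
  case True
  then obtain b where "(a, b) \<in> G" by auto
  then show ?thesis using G by (intro exI[of _ b]) (simp add: insert_absorb)
next
  case False
  have iso: "R x y \<longleftrightarrow> S x' y'" if "(x, x') \<in> G" "(y, y') \<in> G" for x x' y y'
    using G(2) that unfolding partial_iso_def by fast
  define L where "L = G `` {x. R x a}"
  define U where "U = G `` {x. R a x}"
  have "finite (Range G)" "finite L" "finite U"
    using G(1) by (auto simp: L_def U_def finite_Range intro: finite_subset[OF _ finite_Range])
  moreover have "S l u \<and> l \<noteq> u" if lu: "l \<in> L" "u \<in> U" for l u
  proof -
    obtain x y where xy: "(x, l) \<in> G" "R x a" "(y, u) \<in> G" "R a y"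
      using lu by (auto simp: L_def U_def)
    then have "S l u" using iso is_poD(3)[OF R] by blast
    moreover have "l \<noteq> u"
    proof
      assume "l = u"
      then have "R y x" using iso xy is_poD(1)[OF S(1)] by blast
      then have "R a x" using xy(4) is_poD(3)[OF R] by blast
      then have "x = a" using xy(2) is_poD(2)[OF R] by blast
      then show False using xy(1) False by auto
    qed
    ultimately show ?thesis by simp
  qed
  ultimately have "\<exists>b. \<forall>y\<in>Range G. (S y b \<longleftrightarrow> (\<exists>l\<in>L. S y l)) \<and> (S b y \<longleftrightarrow> (\<exists>u\<in>U. S u y))"
    by (intro S(2)[unfolded extension_property_def, rule_format]) simp
  then obtain b where b: "\<And>y. y \<in> Range G \<Longrightarrow>
      (S y b \<longleftrightarrow> (\<exists>l\<in>L. S y l)) \<and> (S b y \<longleftrightarrow> (\<exists>u\<in>U. S u y))"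
    by blast
  have "S y b \<longleftrightarrow> R x a" "S b y \<longleftrightarrow> R a x" if xy: "(x, y) \<in> G" for x y
  proof -
    have "(\<exists>l\<in>L. S y l) \<longleftrightarrow> R x a"
      unfolding L_def using xy iso is_poD(1)[OF S(1)] is_poD(3)[OF R] by blast
    moreover have "(\<exists>u\<in>U. S u y) \<longleftrightarrow> R a x"
      unfolding U_def using xy iso is_poD(1)[OF S(1)] is_poD(3)[OF R] by blast
    ultimately show "S y b \<longleftrightarrow> R x a" "S b y \<longleftrightarrow> R a x" using b xy by blast+
  qed
  then have "partial_iso R S (insert (a, b) G)"
    using iso is_poD(1)[OF R] is_poD(1)[OF S(1)] unfolding partial_iso_def by auto
  then show ?thesis ..
qed

text \<open>Stage \<open>n\<close> puts \<open>n\<close> into the domain and then into the range.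
  Least witnesses make the result a function of the orders; lists, unlike sets of pairs, form a
  countable type, which serves measurability.\<close>

primrec back_forth :: "(nat \<Rightarrow> nat \<Rightarrow> bool) \<Rightarrow> (nat \<Rightarrow> nat \<Rightarrow> bool) \<Rightarrow> nat \<Rightarrow> (nat \<times> nat) list" where
  "back_forth R S 0 = []"
| "back_forth R S (Suc n) =
    (let G = back_forth R S n; G' = (n, LEAST b. partial_iso R S (insert (n, b) (set G))) # G
     in (LEAST a. partial_iso R S (insert (a, n) (set G')), n) # G')"

definition back_forth_map :: "(nat \<Rightarrow> nat \<Rightarrow> bool) \<Rightarrow> (nat \<Rightarrow> nat \<Rightarrow> bool) \<Rightarrow> nat \<Rightarrow> nat" where
  "back_forth_map R S n = (LEAST b. partial_iso R S (insert (n, b) (set (back_forth R S n))))"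

lemma back_forth_map_iso:
  assumes R: "is_po R" "extension_property R" and S: "is_po S" "extension_property S"
  shows "bij (back_forth_map R S)"
    and "\<And>x y. R x y \<longleftrightarrow> S (back_forth_map R S x) (back_forth_map R S y)"
proof -
  let ?G = "\<lambda>n. set (back_forth R S n)" and ?h = "back_forth_map R S"
  have ex_forth: "\<exists>b. partial_iso R S (insert (a, b) (set G))" if "partial_iso R S (set G)" for a G
    using partial_iso_extend[OF R(1) S _ that] by simp
  \<comment> \<open>The back step is the forth step for the converse relation.\<close>
  have ex_back: "\<exists>a. partial_iso R S (insert (a, b) (set G))" if "partial_iso R S (set G)" for b G
  proof -
    have *: "insert (b, a) ((set G)\<inverse>) = (insert (a, b) (set G))\<inverse>" for a
      by auto
    show ?thesis
      using partial_iso_extend[OF S(1) R, of "(set G)\<inverse>" b] that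
      unfolding * partial_iso_converse by simp
  qed
  have step: "partial_iso R S (?G (Suc n)) \<and> (n, ?h n) \<in> ?G (Suc n) \<and> n \<in> Range (?G (Suc n))"
    if "partial_iso R S (?G n)" for n
  proof -
    have "partial_iso R S (insert (n, ?h n) (?G n))"
      unfolding back_forth_map_def using ex_forth[OF that] by (rule LeastI_ex)
    then have *: "partial_iso R S (set ((n, ?h n) # back_forth R S n))" by simp
    show ?thesis
      using LeastI_ex[OF ex_back[OF *], of n]
      by (auto simp: Let_def back_forth_map_def[symmetric])
  qed
  have iso: "partial_iso R S (?G n)" for n
  proof (induction n)
    case 0
    show ?case by (simp add: partial_iso_def)
  next
    case (Suc n)
    then show ?case using step by blast
  qed
  have "?G n \<subseteq> ?G (Suc n)" for n by (auto simp: Let_def)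
  then have mono: "?G m \<subseteq> ?G n" if "m \<le> n" for m n
    by (rule lift_Suc_mono_le) (rule that)
  have iff: "R a a' \<longleftrightarrow> S b b'" if "(a, b) \<in> ?G m" "(a', b') \<in> ?G n" for a b a' b' m n
    using that iso[of "max m n"] mono[of m "max m n"] mono[of n "max m n"]
    unfolding partial_iso_def by fastforce
  have h: "(n, ?h n) \<in> ?G (Suc n)" for n using step[OF iso] by blast
  show *: "R x y \<longleftrightarrow> S (?h x) (?h y)" for x y
    using iff[OF h h] .
  have "inj ?h"
    by (rule injI) (metis * is_poD(1,2)[OF R(1)] is_poD(1)[OF S(1)])
  moreover have "\<exists>x. ?h x = y" for y
  proof -
    \<comment> \<open>Stage \<open>y\<close> pairs \<open>y\<close> with some \<open>x\<close>;
      comparison with the pair of \<open>x\<close> and \<open>?h x\<close> identifies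
      \<open>?h x\<close> with \<open>y\<close> by antisymmetry.\<close>
    obtain x where x: "(x, y) \<in> ?G (Suc y)" using step[OF iso[of y]] by blast
    then have "S (?h x) y" "S y (?h x)"
      using iff[OF h x] iff[OF x h] is_poD(1)[OF R(1)] by blast+
    then show ?thesis using is_poD(2)[OF S(1)] by blast
  qed
  ultimately show "bij ?h" unfolding bij_def surj_def by metis
qed

text \<open>For a fixed list each choice is the least number with a measurable property. The
  preceding list takes only countably many values, so substituting it keeps measurability.\<close>

lemma measurable_back_forth_map:
  assumes R: "\<And>a b. Measurable.pred M (\<lambda>x. R x a b)"
  shows "(\<lambda>x. back_forth_map (R x) S n) \<in> measurable M (count_space UNIV)"
proof -
  have pi[measurable]: "Measurable.pred M (\<lambda>x. partial_iso (R x) S G)" for G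
    unfolding partial_iso_def split_beta by (intro pred_intros_countable_bounded pred_intros_logic R) simp
  have [measurable]: "(\<lambda>x. back_forth (R x) S n) \<in> measurable M (count_space UNIV)" for n
  proof (induction n)
    case (Suc n)
    have forth: "(\<lambda>x. (n, LEAST b. partial_iso (R x) S (insert (n, b) (set G))) # G)
        \<in> measurable M (count_space UNIV)" for G
      by measurable
    have bck: "(\<lambda>x. (LEAST a. partial_iso (R x) S (insert (a, n) (set G)), n) # G)
        \<in> measurable M (count_space UNIV)" for G
      by measurable
    show ?case
      unfolding back_forth.simps Let_def
      by (rule measurable_compose_countable[OF bck measurable_compose_countable[OF forth Suc]])
  qed simp
  have least: "(\<lambda>x. LEAST b. partial_iso (R x) S (insert (n, b) (set G))) \<in> measurable M (count_space UNIV)" for G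
    by measurable
  show ?thesis
    unfolding back_forth_map_def by (rule measurable_compose_countable[OF least]) measurable
qed

section \<open>From partial orders to conjugacy\<close>

lemma extension_property_vimage:
  fixes d :: "'a \<Rightarrow> 'b"
  assumes d: "bij d" and R: "extension_property R"
  shows "extension_property (\<lambda>x y. R (d x) (d y))"
  unfolding extension_property_def
proof (intro allI impI, elim conjE)
  fix F L U :: "'a set"
  assume fin: "finite F" "finite L" "finite U" and LU: "\<forall>l\<in>L. \<forall>u\<in>U. R (d l) (d u) \<and> l \<noteq> u"
  have "finite (d ` F) \<and> finite (d ` L) \<and> finite (d ` U) \<and>
      (\<forall>l\<in>d ` L. \<forall>u\<in>d ` U. R l u \<and> l \<noteq> u)"
    using fin LU by (auto simp: bij_is_inj[OF d] inj_eq)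
  from R[unfolded extension_property_def, THEN spec, THEN spec, THEN spec, THEN mp, OF this]
  obtain x where x: "\<forall>y\<in>d ` F. (R y x \<longleftrightarrow> (\<exists>l\<in>d ` L. R y l)) \<and> (R x y \<longleftrightarrow> (\<exists>u\<in>d ` U. R u y))"
    by blast
  obtain z where "x = d z" using d by (metis bij_pointE)
  then show "\<exists>x. \<forall>y\<in>F. (R (d y) (d x) \<longleftrightarrow> (\<exists>l\<in>L. R (d y) (d l))) \<and>
      (R (d x) (d y) \<longleftrightarrow> (\<exists>u\<in>U. R (d u) (d y)))"
    using x by auto
qed

text \<open>A conjugating automorphism \<alpha> corresponds to
  \<open>\<beta> = inv H' \<circ> \<alpha> \<circ> H\<close>: conjugating one transported copy of
  \<sigma> into the other means that \<beta> commutes with \<sigma>.\<close>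

lemma conj_rel_transport_iff:
  assumes H: "bij H" "\<And>s t. R s t \<longleftrightarrow> P (H s) (H t)"
    and H': "bij H'" "\<And>s t. R' s t \<longleftrightarrow> P (H' s) (H' t)"
  shows "conj_rel P (H \<circ> \<sigma> \<circ> inv H) (H' \<circ> \<sigma> \<circ> inv H') \<longleftrightarrow>
    (\<exists>\<beta>. bij \<beta> \<and> (\<forall>s t. R s t \<longleftrightarrow> R' (\<beta> s) (\<beta> t)) \<and> (\<forall>s. \<beta> (\<sigma> s) = \<sigma> (\<beta> s)))"
proof
  have inv: "inv H (H s) = s" "inv H' (H' s) = s" "H (inv H n) = n" "H' (inv H' n) = n" for s n
    using H(1) H'(1) by (simp_all add: bij_is_inj bij_is_surj surj_f_inv_f)
  {
    assume "conj_rel P (H \<circ> \<sigma> \<circ> inv H) (H' \<circ> \<sigma> \<circ> inv H')"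
    then obtain \<alpha> where \<alpha>: "bij \<alpha>" "\<And>x y. P x y \<longleftrightarrow> P (\<alpha> x) (\<alpha> y)"
      and eq: "\<alpha> \<circ> (H \<circ> \<sigma> \<circ> inv H) \<circ> inv \<alpha> = H' \<circ> \<sigma> \<circ> inv H'"
      by (auto simp: conj_rel_def Aut_def)
    have "\<alpha> (H (\<sigma> s)) = H' (\<sigma> (inv H' (\<alpha> (H s))))" for s
      using fun_cong[OF eq, of "\<alpha> (H s)"] \<alpha>(1) by (simp add: inv bij_is_inj)
    then show "\<exists>\<beta>. bij \<beta> \<and> (\<forall>s t. R s t \<longleftrightarrow> R' (\<beta> s) (\<beta> t)) \<and> (\<forall>s. \<beta> (\<sigma> s) = \<sigma> (\<beta> s))"
      using H(1) H'(1) \<alpha>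
      by (intro exI[of _ "inv H' \<circ> \<alpha> \<circ> H"])
        (auto simp: H(2) H'(2) inv intro!: bij_comp bij_imp_bij_inv)
  next
    assume "\<exists>\<beta>. bij \<beta> \<and> (\<forall>s t. R s t \<longleftrightarrow> R' (\<beta> s) (\<beta> t)) \<and> (\<forall>s. \<beta> (\<sigma> s) = \<sigma> (\<beta> s))"
    then obtain \<beta> where \<beta>: "bij \<beta>" "\<And>s t. R s t \<longleftrightarrow> R' (\<beta> s) (\<beta> t)" "\<And>s. \<beta> (\<sigma> s) = \<sigma> (\<beta> s)"
      by auto
    define \<alpha> where "\<alpha> = H' \<circ> \<beta> \<circ> inv H"
    have bij: "bij \<alpha>"
      unfolding \<alpha>_def using H(1) H'(1) \<beta>(1) by (intro bij_comp bij_imp_bij_inv)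
    have "P x y \<longleftrightarrow> P (\<alpha> x) (\<alpha> y)" for x y
      using H(2)[of "inv H x" "inv H y"] by (simp add: \<alpha>_def \<beta>(2) H'(2) inv)
    then have "\<alpha> \<in> Aut P" using bij by (simp add: Aut_def)
    moreover have "(\<alpha> \<circ> (H \<circ> \<sigma> \<circ> inv H) \<circ> inv \<alpha>) n = (H' \<circ> \<sigma> \<circ> inv H') n" for n
    proof -
      obtain m where m: "n = \<alpha> m" using bij by (metis bij_pointE)
      show ?thesis
        unfolding m using bij by (simp add: bij_is_inj) (simp add: \<alpha>_def inv \<beta>(3))
    qed
    ultimately show "conj_rel P (H \<circ> \<sigma> \<circ> inv H) (H' \<circ> \<sigma> \<circ> inv H')"
      unfolding conj_rel_def by blast
  }
qed

section \<open>The shift and its fixed points\<close>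

abbreviation ext_shift :: "('a, int) ext \<Rightarrow> ('a, int) ext" where
  "ext_shift \<equiv> map_ext id (\<lambda>k. k + 1)"

lemma bij_plus_one: "bij (\<lambda>k::int. k + 1)"
  by (rule bij_betw_byWitness[where f' = "\<lambda>k. k - 1"]) auto

text \<open>Already the outermost index of an \<open>Ext\<close> term changes, while base points
  carry no index.\<close>

lemma ext_shift_fixed_iff: "ext_shift t = t \<longleftrightarrow> t \<in> range Base"
  by (cases t) auto

text \<open>From left to right, \<beta> preserves the fixed points of the shift, which form a copy
  of the base order. From right to left, \<open>map_ext g id\<close> acts on base points only and so
  commutes with the shift of indices.\<close>

lemma ext_le_shift_iso_iff:
  assumes Q: "reflp Q" "reflp Q'"
  shows "(\<exists>\<beta>. bij \<beta> \<and> (\<forall>s t. ext_le Q s t \<longleftrightarrow> ext_le Q' (\<beta> s) (\<beta> t)) \<and>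
      (\<forall>s. \<beta> (ext_shift s) = ext_shift (\<beta> s))) \<longleftrightarrow>
    (\<exists>g. bij g \<and> (\<forall>a b. Q a b \<longleftrightarrow> Q' (g a) (g b)))"
proof
  assume "\<exists>g. bij g \<and> (\<forall>a b. Q a b \<longleftrightarrow> Q' (g a) (g b))"
  then obtain g where g: "bij g" "\<And>a b. Q a b \<longleftrightarrow> Q' (g a) (g b)" by blast
  show "\<exists>\<beta>. bij \<beta> \<and> (\<forall>s t. ext_le Q s t \<longleftrightarrow> ext_le Q' (\<beta> s) (\<beta> t)) \<and>
      (\<forall>s. \<beta> (ext_shift s) = ext_shift (\<beta> s))"
    by (intro exI[of _ "map_ext g id"] conjI allI bij_map_ext g(1) bij_id
        ext_le_map_iff[of Q Q' g, OF g(2), symmetric]) (simp add: ext.map_comp comp_def id_def)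
next
  assume "\<exists>\<beta>. bij \<beta> \<and> (\<forall>s t. ext_le Q s t \<longleftrightarrow> ext_le Q' (\<beta> s) (\<beta> t)) \<and>
      (\<forall>s. \<beta> (ext_shift s) = ext_shift (\<beta> s))"
  then obtain \<beta> where \<beta>: "bij \<beta>" "\<And>s t. ext_le Q s t \<longleftrightarrow> ext_le Q' (\<beta> s) (\<beta> t)"
    "\<And>s. \<beta> (ext_shift s) = ext_shift (\<beta> s)" by blast
  have fixed: "\<beta> t \<in> range Base \<longleftrightarrow> t \<in> range Base" for t
    unfolding ext_shift_fixed_iff[symmetric] \<beta>(3)[symmetric]
    using \<beta>(1) by (simp add: bij_is_inj inj_eq)
  have "\<exists>b. \<beta> (Base a) = Base b" for a
    using fixed[of "Base a"] by auto
  then obtain g where g: "\<And>a. \<beta> (Base a) = Base (g a)" by metis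
  have "inj g"
    by (rule injI) (metis g \<beta>(1) bij_is_inj inj_eq ext.inject(1))
  moreover have "\<exists>a. g a = b" for b
  proof -
    obtain t where t: "\<beta> t = Base b" using \<beta>(1) by (metis bij_pointE)
    then show ?thesis using fixed[of t] g by auto
  qed
  moreover have "Q a b \<longleftrightarrow> Q' (g a) (g b)" for a b
    using \<beta>(2)[of "Base a" "Base b"] by (simp add: g ext_le_Base_iff Q)
  ultimately show "\<exists>g. bij g \<and> (\<forall>a b. Q a b \<longleftrightarrow> Q' (g a) (g b))"
    unfolding bij_def surj_def by metis
qed

text \<open>The reduction \<open>f\<close> transports the shift to \<open>P\<close>. The general
  countable carrier covers both partial orders on \<open>nat\<close> and orders of nodes.\<close>

lemma borel_reducible_iso_conj_rel:
  fixes Q :: "'x \<Rightarrow> 'a::countable \<Rightarrow> 'a \<Rightarrow> bool"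
  assumes P: "generic_po P"
    and meas: "\<And>a b. Measurable.pred M (\<lambda>x. Q x a b)"
    and po: "\<And>x. x \<in> space M \<Longrightarrow> reflp (Q x)" "\<And>x. x \<in> space M \<Longrightarrow> antisymp (Q x)"
      "\<And>x. x \<in> space M \<Longrightarrow> transp (Q x)"
  shows "borel_reducible M (\<lambda>x y. \<exists>g. bij g \<and> (\<forall>a b. Q x a b \<longleftrightarrow> Q y (g a) (g b)))
    (Aut_space P) (conj_rel P)"
proof -
  have "infinite (range (\<lambda>k::int. Ext [] [] k :: ('a, int) ext))"
    by (subst finite_image_iff) (auto simp: inj_on_def infinite_UNIV_int)
  then have inf: "infinite (UNIV :: ('a, int) ext set)"
    by (rule infinite_super[OF subset_UNIV])
  then obtain d :: "nat \<Rightarrow> ('a, int) ext" where d: "bij d"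
    using countable_infiniteE'[of "UNIV :: ('a, int) ext set"] by auto
  have inv_d: "d (inv d t) = t" "inv d (d n) = n" for t n
    using d by (simp_all add: bij_is_inj bij_is_surj surj_f_inv_f)
  define R where "R x m n = ext_le (Q x) (d m) (d n)" for x m n
  define h where "h x = back_forth_map (R x) P" for x
  define H where "H x = h x \<circ> inv d" for x
  define f where "f x = H x \<circ> ext_shift \<circ> inv (H x)" for x
  have poP: "is_po P" and extP: "extension_property P"
    using P extension_property_generic_po by (auto simp: generic_po_def)
  have R: "is_po (R x)" "extension_property (R x)" if x: "x \<in> space M" for x
  proof -
    show "is_po (R x)"
      unfolding is_po_def R_def
      using ext_le.refl ext_le_antisym[OF po(3,2)[OF x]] ext_le_trans[OF po(3)[OF x]]
        bij_is_inj[OF d] by (meson injD)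
    show "extension_property (R x)"
      unfolding R_def using infinite_UNIV_int
      by (intro extension_property_vimage[OF d] extension_property_ext_le) auto
  qed
  have h: "bij (h x)" "R x m n \<longleftrightarrow> P (h x m) (h x n)" if "x \<in> space M" for x m n
    using back_forth_map_iso[OF R[OF that] poP extP] unfolding h_def by auto
  have H: "bij (H x)" "ext_le (Q x) s t \<longleftrightarrow> P (H x s) (H x t)" if "x \<in> space M" for x s t
    using h[OF that] d unfolding H_def
    by (auto simp: R_def inv_d intro!: bij_comp bij_imp_bij_inv simp flip: h(2)[OF that])
  have f_Aut: "f x \<in> Aut P" if x: "x \<in> space M" for x
  proof -
    note shift = bij_map_ext[OF bij_id bij_plus_one]
    have "bij (f x)"
      unfolding f_def using H(1)[OF x] shift by (intro bij_comp bij_imp_bij_inv)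
    moreover have "P m n \<longleftrightarrow> P (f x m) (f x n)" for m n
    proof -
      obtain s t where st: "m = H x s" "n = H x t" using H(1)[OF x] by (metis bij_pointE)
      show ?thesis
        unfolding st f_def using H(1)[OF x] ext_le_map_iff[of "Q x" "Q x" id "\<lambda>k. k + 1" s t, OF _ bij_id bij_plus_one]
        by (simp add: bij_is_inj flip: H(2)[OF x])
    qed
    ultimately show ?thesis by (simp add: Aut_def)
  qed
  have h_meas: "(\<lambda>x. h x n) \<in> measurable M (count_space UNIV)" for n
    unfolding h_def R_def by (intro measurable_back_forth_map pred_ext_le meas)
  have f_meas: "(\<lambda>x. f x n) \<in> measurable M (count_space UNIV)" for n
  proof -
    \<comment> \<open>The inverse of \<open>H x\<close> is replaced by a least search with
      \<open>h x\<close>, so that \<open>f\<close> is composed of measurable maps with countably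
      many values.\<close>
    have eq: "f x n = h x (inv d (ext_shift (d (LEAST a. h x a = n))))" if x: "x \<in> space M" for x
    proof -
      obtain a where a: "h x a = n" using h(1)[OF x] by (metis bij_pointE)
      have "(LEAST a. h x a = n) = a"
        using a h(1)[OF x] by (intro Least_equality) (auto simp: bij_is_inj inj_eq)
      moreover have "inv (H x) n = d a"
        using H(1)[OF x] a by (intro inv_f_eq) (auto simp: bij_is_inj H_def inv_d)
      ultimately show ?thesis by (simp add: f_def H_def)
    qed
    have "(\<lambda>x. LEAST a. h x a = n) \<in> measurable M (count_space UNIV)"
      using h_meas by measurable
    then have "(\<lambda>x. h x (inv d (ext_shift (d (LEAST a. h x a = n))))) \<in> measurable M (count_space UNIV)"
      by (rule measurable_compose_countable[OF h_meas])
    then show ?thesis by (simp add: eq cong: measurable_cong)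
  qed
  have "(\<lambda>x n. f x n) \<in> measurable M baire_space"
    unfolding baire_space_def by (rule measurable_PiM_single') (use f_meas in auto)
  then have "f \<in> measurable M (Aut_space P)"
    unfolding Aut_space_def using f_Aut by (intro measurable_restrict_space2) auto
  moreover have "(\<exists>g. bij g \<and> (\<forall>a b. Q x a b \<longleftrightarrow> Q y (g a) (g b))) \<longleftrightarrow> conj_rel P (f x) (f y)"
    if "x \<in> space M" "y \<in> space M" for x y
    unfolding f_def
      conj_rel_transport_iff[of "H x" "ext_le (Q x)" P "H y" "ext_le (Q y)", OF H[OF that(1)] H[OF that(2)]]
      ext_le_shift_iso_iff[OF po(1)[OF that(1)] po(1)[OF that(2)]] ..
  ultimately show ?thesis unfolding borel_reducible_def by blast
qed

section \<open>Coding countable structures by partial orders\<close>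

text \<open>
  The coordinate \<open>j\<close> of the tuple \<open>xs\<close> of relation \<open>i\<close> is a node lying over the element
  \<open>xs ! j\<close> and under the node of the tuple. Labels have to increase along the order; the residue
  modulo 3 of the label separates coordinates, false tuples and true tuples.
\<close>

datatype node = Const nat | Elem nat | Coord nat "nat list" nat | Tuple nat "nat list"

instance node :: countable
  by countable_datatype

text \<open>The offset 3 for true tuples keeps their labels away from the label 0 of elements. Since
  \<open>length xs\<close> \<le> \<open>prod_encode (i, length xs)\<close>, a coordinate with
  \<open>j < length xs\<close> is labelled below its tuple.\<close>

fun label :: "(nat \<Rightarrow> nat list \<Rightarrow> bool) \<Rightarrow> node \<Rightarrow> nat" where
  "label S (Const m) = m"
| "label S (Elem a) = 0"
| "label S (Coord i xs j) = 3 * j + 1"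
| "label S (Tuple i xs) = 3 * prod_encode (i, length xs) + (if S i xs then 3 else 2)"

text \<open>\<open>S\<close> enters only through the labels, and the set of nodes is the same for
  all structures. The label of a node is the largest \<open>m\<close> such that
  \<open>Const m\<close> lies below it.\<close>

fun node_le :: "(nat \<Rightarrow> nat list \<Rightarrow> bool) \<Rightarrow> node \<Rightarrow> node \<Rightarrow> bool" where
  "node_le S (Const m) y \<longleftrightarrow> m \<le> label S y"
| "node_le S (Elem a) (Elem b) \<longleftrightarrow> a = b"
| "node_le S (Elem a) (Coord i xs j) \<longleftrightarrow> j < length xs \<and> xs ! j = a"
| "node_le S (Elem a) (Tuple i xs) \<longleftrightarrow> a \<in> set xs"
| "node_le S (Coord i xs j) (Coord i' xs' j') \<longleftrightarrow> i = i' \<and> xs = xs' \<and> j = j'"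
| "node_le S (Coord i xs j) (Tuple i' xs') \<longleftrightarrow> i = i' \<and> xs = xs' \<and> j < length xs"
| "node_le S (Tuple i xs) (Tuple i' xs') \<longleftrightarrow> i = i' \<and> xs = xs'"
| "node_le S _ _ \<longleftrightarrow> False"

lemma label_mono: "node_le S x y \<Longrightarrow> label S x \<le> label S y"
proof (induction S x y rule: node_le.induct)
  case (6 S i xs j i' xs')
  then show ?case using le_prod_encode_2[of "length xs" i] by auto
qed auto

lemma node_le_po: "reflp (node_le S)" "antisymp (node_le S)" "transp (node_le S)"
proof -
  show "reflp (node_le S)"
  proof (rule reflpI)
    show "node_le S x x" for x by (cases x) auto
  qed
  show "antisymp (node_le S)"
  proof (rule antisympI)
    show "x = y" if "node_le S x y" "node_le S y x" for x y
      using that by (cases x; cases y) auto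
  qed
  show "transp (node_le S)"
  proof (rule transpI)
    show "node_le S x z" if "node_le S x y" "node_le S y z" for x y z
      using that label_mono[of S y z] by (cases x; cases y; cases z) auto
  qed
qed

text \<open>Outside the constants, chains have at most three elements.\<close>

lemma Const_iff_chain:
  "x \<in> range Const \<longleftrightarrow> (\<exists>u v w. node_le S x u \<and> x \<noteq> u \<and> node_le S u v \<and> u \<noteq> v \<and> node_le S v w \<and> v \<noteq> w)"
  (is "_ \<longleftrightarrow> ?chain")
proof
  assume "x \<in> range Const"
  then obtain m where "x = Const m" by auto
  then show ?chain
    by (intro exI[of _ "Const (m + 1)"] exI[of _ "Const (m + 2)"] exI[of _ "Const (m + 3)"]) auto
next
  assume ?chain
  \<comment> \<open>A rank that rises along every proper step from a node outside the constants; its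
    three values leave no room for three consecutive steps.\<close>
  define r :: "node \<Rightarrow> nat" where "r = case_node (\<lambda>_. 0) (\<lambda>_. 0) (\<lambda>_ _ _. 1) (\<lambda>_ _. 2)"
  have step: "y \<notin> range Const \<and> r x < r y" if "node_le S x y" "x \<noteq> y" "x \<notin> range Const" for x y
    using that by (cases x; cases y) (auto simp: r_def)
  have bound: "r x \<le> 2" for x by (simp add: r_def split: node.split)
  show "x \<in> range Const"
  proof (rule ccontr)
    assume "x \<notin> range Const"
    with \<open>?chain\<close> obtain u v w where "r x < r u" "r u < r v" "r v < r w"
      using step by metis
    then show False using bound[of w] by simp
  qed
qed

text \<open>Rigidity of omega: a strictly increasing map satisfies \<open>n\<close> \<le>
  \<open>g n\<close>, and the same bound for the inverse gives the converse inequality.\<close>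

lemma order_iso_nat_eq_id:
  fixes g :: "nat \<Rightarrow> nat"
  assumes "surj g" "\<And>m n. m \<le> n \<longleftrightarrow> g m \<le> g n"
  shows "g n = n"
proof -
  have g: "strict_mono g" using assms(2) by (simp add: strict_mono_def flip: not_le)
  have inv: "g (inv g m) = m" for m using assms(1) by (simp add: surj_f_inv_f)
  have "strict_mono (inv g)"
    unfolding strict_mono_def using assms(2) inv by (metis not_le)
  then have "g n \<le> inv g (g n)" by (rule strict_mono_imp_increasing)
  also have "inv g (g n) = n" using strict_mono_imp_inj_on[OF g] by simp
  finally show ?thesis using strict_mono_imp_increasing[OF g, of n] by simp
qed

text \<open>The chain condition defines the constants, so \<open>h\<close> restricts to an
  automorphism of a chain of type omega, which is the identity. Labels are read off from the
  constants below a node and are therefore preserved.\<close>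

lemma
  assumes h: "bij h" "\<And>x y. node_le S x y \<longleftrightarrow> node_le T (h x) (h y)"
  shows node_iso_Const: "h (Const m) = Const m" and node_iso_label: "label T (h x) = label S x"
proof -
  have Const: "h x \<in> range Const \<longleftrightarrow> x \<in> range Const" for x
  proof -
    have ex: "(\<exists>u. p u) \<longleftrightarrow> (\<exists>u. p (h u))" for p using h(1) by (metis bij_pointE)
    show ?thesis
      unfolding Const_iff_chain[of "h x" T] Const_iff_chain[of x S] h(2)
      by (subst ex, subst (2) ex, subst (3) ex) (simp add: inj_eq[OF bij_is_inj[OF h(1)]])
  qed
  have "\<exists>n. h (Const m) = Const n" for m using Const[of "Const m"] by auto
  then obtain g where g: "\<And>m. h (Const m) = Const (g m)" by metis
  have id: "g m = m" for m
  proof (rule order_iso_nat_eq_id)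
    have "\<exists>m. n = g m" for n
    proof -
      obtain x where x: "h x = Const n" using h(1) by (metis bij_pointE)
      then show ?thesis using Const[of x] g by auto
    qed
    then show "surj g" unfolding surj_def by blast
    show "m \<le> n \<longleftrightarrow> g m \<le> g n" for m n
      using h(2)[of "Const m" "Const n"] by (simp add: g)
  qed
  then show "h (Const m) = Const m" by (simp add: g)
  have "m \<le> label S x \<longleftrightarrow> m \<le> label T (h x)" for m
    using h(2)[of "Const m" x] by (simp add: g id)
  then show "label T (h x) = label S x" by (metis le_antisym order_refl)
qed

text \<open>Label 0 means an element; otherwise the residues 1, 2 and 0 modulo 3 mean coordinate,
  false tuple and true tuple, and the rest of the label decodes to \<open>j\<close> or to the symbol
  with the length.\<close>

lemma label_eq_cases:
  assumes "label T y = label S x" "x \<notin> range Const" "y \<notin> range Const"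
  shows "x = Elem a \<Longrightarrow> \<exists>b. y = Elem b"
    and "x = Coord i xs j \<Longrightarrow> \<exists>i' ys. y = Coord i' ys j"
    and "x = Tuple i xs \<Longrightarrow> \<exists>ys. y = Tuple i ys \<and> length ys = length xs \<and> (S i xs \<longleftrightarrow> T i ys)"
proof -
  show "x = Elem a \<Longrightarrow> \<exists>b. y = Elem b"
    using assms by (cases y) (auto split: if_splits)
  show "x = Coord i xs j \<Longrightarrow> \<exists>i' ys. y = Coord i' ys j"
    using assms by (cases y) (auto split: if_splits, presburger+)
  show "x = Tuple i xs \<Longrightarrow> \<exists>ys. y = Tuple i ys \<and> length ys = length xs \<and> (S i xs \<longleftrightarrow> T i ys)"
    using assms by (cases y) (auto split: if_splits, presburger+)
qed

text \<open>A bijection of the universe lifts entrywise to nodes. Conversely, a node isomorphism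
  preserves labels, hence kinds of nodes; its action on elements is the required bijection, and the
  coordinates show that it acts entrywise on tuples.\<close>

lemma struct_iso_iff_node_iso:
  "struct_iso S T \<longleftrightarrow> (\<exists>h. bij h \<and> (\<forall>x y. node_le S x y \<longleftrightarrow> node_le T (h x) (h y)))"
proof
  assume "struct_iso S T"
  then obtain g where g: "bij g" "\<And>i xs. S i xs \<longleftrightarrow> T i (map g xs)"
    by (auto simp: struct_iso_def)
  have inv: "g (inv g x) = x" "inv g (g x) = x" for x
    using g(1) by (simp_all add: bij_is_inj bij_is_surj surj_f_inv_f)
  define lift where "lift f = case_node Const (\<lambda>a. Elem (f a)) (\<lambda>i xs j. Coord i (map f xs) j)
      (\<lambda>i xs. Tuple i (map f xs))" for f :: "nat \<Rightarrow> nat"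
  have "bij (lift g)"
    by (rule bij_betw_byWitness[where f' = "lift (inv g)"])
      (auto simp: lift_def inv comp_def split: node.split)
  moreover have "node_le S x y \<longleftrightarrow> node_le T (lift g x) (lift g y)" for x y
    using bij_is_inj[OF g(1)]
    by (cases x; cases y) (auto simp: lift_def g(2) inj_eq inj_map_eq_map)
  ultimately show "\<exists>h. bij h \<and> (\<forall>x y. node_le S x y \<longleftrightarrow> node_le T (h x) (h y))"
    by blast
next
  assume "\<exists>h. bij h \<and> (\<forall>x y. node_le S x y \<longleftrightarrow> node_le T (h x) (h y))"
  then obtain h where h: "bij h" "\<And>x y. node_le S x y \<longleftrightarrow> node_le T (h x) (h y)" by blast
  note Const = node_iso_Const[OF h] and lab = node_iso_label[OF h]
  have nConst: "h x \<notin> range Const" if "x \<notin> range Const" for x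
    using that Const h(1) by (metis bij_is_inj inj_eq rangeE rangeI)
  have "\<exists>b. h (Elem a) = Elem b" for a
    using label_eq_cases(1)[OF lab _ nConst] by blast
  then obtain g where g: "\<And>a. h (Elem a) = Elem (g a)" by metis
  have "inj g"
    by (rule injI) (metis g h(1) bij_is_inj inj_eq node.inject(2))
  moreover have "\<exists>a. b = g a" for b
  proof -
    obtain x where x: "h x = Elem b" using h(1) by (metis bij_pointE)
    then have "x \<notin> range Const" using Const by auto
    \<comment> \<open>With the roles of \<open>S\<close> and \<open>T\<close> exchanged: the
      preimage of an element node is an element node.\<close>
    then show ?thesis
      using label_eq_cases(1)[of S x T "h x" b] lab[of x] nConst[of x] x g by auto
  qed
  ultimately have "bij g" unfolding bij_def surj_def by blast
  moreover have "S i xs \<longleftrightarrow> T i (map g xs)" for i xs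
  proof -
    obtain ys where ys: "h (Tuple i xs) = Tuple i ys" "length ys = length xs" "S i xs \<longleftrightarrow> T i ys"
      using label_eq_cases(3)[OF lab _ nConst, of "Tuple i xs"] by blast
    have "ys ! j = g (xs ! j)" if j: "j < length xs" for j
    proof -
      obtain i' zs where zs: "h (Coord i xs j) = Coord i' zs j"
        using label_eq_cases(2)[OF lab _ nConst, of "Coord i xs j"] by blast
      \<comment> \<open>The tuple node above the image of the coordinate fixes its list; the element
        node below it then fixes the entry.\<close>
      then have "zs = ys" using h(2)[of "Coord i xs j" "Tuple i xs"] ys(1) j by simp
      then show ?thesis using h(2)[of "Elem (xs ! j)" "Coord i xs j"] zs g j by simp
    qed
    then have "ys = map g xs" using ys(2) by (simp add: list_eq_iff_nth_eq)
    then show ?thesis using ys(3) by simp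
  qed
  ultimately show "struct_iso S T" unfolding struct_iso_def by blast
qed

section \<open>Borel reductions\<close>

lemma space_PiM_UNIV: "space (PiM UNIV (\<lambda>_. M)) = {f. \<forall>x. f x \<in> space M}"
  by (auto simp: space_PiM PiE_def)

lemma measurable_component2:
  "(\<lambda>f. f i j) \<in> measurable (PiM UNIV (\<lambda>_. PiM UNIV (\<lambda>_. count_space UNIV))) (count_space UNIV)"
  by (rule measurable_compose[where f = "\<lambda>f. f i" and g = "\<lambda>f. f j",
        OF measurable_component_singleton measurable_component_singleton]) simp_all

lemma space_PO_space: "space PO_space = {R. is_po R}"
  by (auto simp: PO_space_def rel_space_def space_restrict_space space_PiM_UNIV)

lemma space_struct_space: "space (struct_space I ar) = Mod I ar"
  by (auto simp: struct_space_def space_restrict_space space_PiM_UNIV)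

lemma pred_node_le:
  assumes S: "\<And>i xs. Measurable.pred M (\<lambda>S. S i xs)"
  shows "Measurable.pred M (\<lambda>S. node_le S x y)"
proof -
  note [measurable] = S
  have "Measurable.pred M (\<lambda>S. m \<le> label S y)" for m
    by (cases y) simp_all
  then show ?thesis by (cases x; cases y) simp_all
qed

lemma borel_reducible_struct_iso_conj_rel:
  assumes "generic_po P"
  shows "borel_reducible (class_space I ar C) struct_iso (Aut_space P) (conj_rel P)"
proof -
  have "Measurable.pred (class_space I ar C) (\<lambda>S. S i xs)" for i xs
    unfolding class_space_def struct_space_def
    by (intro measurable_restrict_space1 measurable_component2)
  then show ?thesis
    unfolding struct_iso_iff_node_iso[abs_def]
    by (intro borel_reducible_iso_conj_rel assms pred_node_le node_le_po)
qed

lemma borel_reducible_po_iso_conj_rel: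
  assumes "generic_po P"
  shows "borel_reducible PO_space po_iso (Aut_space P) (conj_rel P)"
  unfolding po_iso_def[abs_def]
proof (rule borel_reducible_iso_conj_rel[OF assms])
  show "Measurable.pred PO_space (\<lambda>R. R a b)" for a b
    unfolding PO_space_def rel_space_def by (intro measurable_restrict_space1 measurable_component2)
  fix R assume "R \<in> space PO_space"
  then have R: "is_po R" by (simp add: space_PO_space)
  show "reflp R" by (rule reflpI) (rule is_poD(1)[OF R])
  show "antisymp R" by (rule antisympI) (rule is_poD(2)[OF R])
  show "transp R" by (rule transpI) (rule is_poD(3)[OF R])
qed

section \<open>Automorphisms as structures with two binary relations\<close>

definition aut_struct :: "(nat \<Rightarrow> nat \<Rightarrow> bool) \<Rightarrow> (nat \<Rightarrow> nat) \<Rightarrow> nat \<Rightarrow> nat list \<Rightarrow> bool" where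
  "aut_struct P \<phi> i xs \<longleftrightarrow> length xs = 2 \<and>
    (i = 0 \<and> P (xs ! 0) (xs ! 1) \<or> i = 1 \<and> \<phi> (xs ! 0) = xs ! 1)"

text \<open>Preserving symbol 0 makes a bijection \<alpha> an automorphism of \<open>P\<close>;
  preserving symbol 1, the graph, says
  \<open>\<psi> \<circ> \<alpha> = \<alpha> \<circ> \<phi>\<close>.\<close>

lemma conj_rel_iff_struct_iso:
  "conj_rel P \<phi> \<psi> \<longleftrightarrow> struct_iso (aut_struct P \<phi>) (aut_struct P \<psi>)"
proof
  assume "conj_rel P \<phi> \<psi>"
  then obtain \<alpha> where \<alpha>: "bij \<alpha>" "\<And>x y. P x y \<longleftrightarrow> P (\<alpha> x) (\<alpha> y)" "\<psi> = \<alpha> \<circ> \<phi> \<circ> inv \<alpha>"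
    by (auto simp: conj_rel_def Aut_def)
  have "aut_struct P \<phi> i xs \<longleftrightarrow> aut_struct P \<psi> i (map \<alpha> xs)" for i xs
    using bij_is_inj[OF \<alpha>(1)] by (auto simp: aut_struct_def \<alpha>(3) \<alpha>(2)[symmetric] inj_eq)
  then show "struct_iso (aut_struct P \<phi>) (aut_struct P \<psi>)"
    using \<alpha>(1) unfolding struct_iso_def by blast
next
  assume "struct_iso (aut_struct P \<phi>) (aut_struct P \<psi>)"
  then obtain \<alpha> where \<alpha>: "bij \<alpha>"
    and iso: "\<And>i xs. aut_struct P \<phi> i xs \<longleftrightarrow> aut_struct P \<psi> i (map \<alpha> xs)"
    by (auto simp: struct_iso_def)
  have "P x y \<longleftrightarrow> P (\<alpha> x) (\<alpha> y)" "\<psi> (\<alpha> x) = \<alpha> (\<phi> x)" for x y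
    using iso[of 0 "[x, y]"] iso[of 1 "[x, \<phi> x]"] by (simp_all add: aut_struct_def)
  moreover have "\<alpha> (inv \<alpha> x) = x" for x using \<alpha> by (simp add: bij_is_surj surj_f_inv_f)
  ultimately have "\<alpha> \<in> Aut P" "\<alpha> \<circ> \<phi> \<circ> inv \<alpha> = \<psi>"
    using \<alpha> by (auto simp: Aut_def fun_eq_iff) metis+
  then show "conj_rel P \<phi> \<psi>" unfolding conj_rel_def by blast
qed

lemma borel_reducible_conj_rel_struct_iso:
  "borel_reducible (Aut_space P) (conj_rel P)
    (class_space {0, 1} (\<lambda>_. 2) (Mod {0, 1} (\<lambda>_. 2))) struct_iso"
proof -
  have "(\<lambda>\<phi>. aut_struct P \<phi> i xs) \<in> measurable (Aut_space P) (count_space UNIV)" for i xs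
    unfolding Aut_space_def baire_space_def aut_struct_def
    by (intro measurable_restrict_space1) measurable
  then have "aut_struct P \<in>
      measurable (Aut_space P) (PiM UNIV (\<lambda>_. PiM UNIV (\<lambda>_. count_space UNIV)))"
    by (intro measurable_PiM_single') (auto simp: space_PiM_UNIV)
  then have "aut_struct P \<in> measurable (Aut_space P) (class_space {0, 1} (\<lambda>_. 2) (Mod {0, 1} (\<lambda>_. 2)))"
    unfolding class_space_def struct_space_def
    by (intro measurable_restrict_space2) (auto simp: Mod_def aut_struct_def[of P])
  then show ?thesis
    unfolding borel_reducible_def by (rule bexI[rotated]) (simp add: conj_rel_iff_struct_iso)
qed

lemma struct_class_Mod: "struct_class I ar (Mod I ar)"
  unfolding struct_class_def using sets.top[of "struct_space I ar"]
  by (simp add: space_struct_space)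

theorem theorem2p2:
  assumes "generic_po P"
  shows "borel_reducible PO_space po_iso (Aut_space P) (conj_rel P)
       \<and> borel_complete (Aut_space P) (conj_rel P)"
  unfolding borel_complete_def
  by (intro conjI exI[of _ "{0, 1}"] exI[of _ "\<lambda>_. 2"] exI[of _ "Mod {0, 1} (\<lambda>_. 2)"]
      allI impI borel_reducible_po_iso_conj_rel[OF assms] borel_reducible_struct_iso_conj_rel[OF assms] struct_class_Mod
      borel_reducible_conj_rel_struct_iso)

end
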